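(* Let $m,n\geq1$ and let $a_m,b_n$ be nonzero complex numbers. The resultant $R=a_m^n b_n^m\prod_{i=1}^m\prod_{j=1}^n(x_i-y_j)$, regarded as a polynomial in $\mathbb{C}[x_1,\ldots,x_m,y_1,\ldots,y_n]$, has saturated Newton polytope.
   Context: Here $R$ is the resultant of $f=\sum_{i=0}^m a_iz^i$ and $g=\sum_{i=0}^n b_iz^i$ of degrees $m,n$ with roots $x_1,\ldots,x_m$ and $y_1,\ldots,y_n$ respectively, the roots being treated as indeterminates. For a polynomial $h=\sum c_\gamma z^\gamma$, its Newton polytope is $\mathrm{conv}\{\gamma:c_\gamma\neq0\}$, and $h$ has saturated Newton polytope (SNP) if every lattice point of its Newton polytope is an exponent vector $\gamma$ with $c_\gamma\neq0$. *)

theory Defs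
  imports "HOL-Analysis.Analysis" "HOL-Library.Poly_Mapping"
begin

text \<open>
  Polynomials with coefficients in \<open>'a\<close> and a finite type \<open>'v\<close> of variables: finitely supported
  maps from exponent vectors to coefficients, multiplied by convolution. The exponent vectors
  occurring in \<open>h\<close> with nonzero coefficient are \<open>Poly_Mapping.keys h\<close>.
\<close>

type_synonym ('v, 'a) mpoly = "('v \<Rightarrow>\<^sub>0 nat) \<Rightarrow>\<^sub>0 'a"

definition mp_const :: "'a::zero \<Rightarrow> ('v, 'a) mpoly" where
  "mp_const c = Poly_Mapping.single 0 c"

definition mp_var :: "'v \<Rightarrow> ('v, 'a::zero_neq_one) mpoly" where
  "mp_var v = Poly_Mapping.single (Poly_Mapping.single v 1) 1"

definition exponent_point :: "('v::finite \<Rightarrow>\<^sub>0 nat) \<Rightarrow> real ^ 'v" where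
  "exponent_point \<gamma> = (\<chi> v. real (Poly_Mapping.lookup \<gamma> v))"

definition newton_polytope :: "('v::finite, 'a::zero) mpoly \<Rightarrow> (real ^ 'v) set" where
  "newton_polytope h = convex hull (exponent_point ` Poly_Mapping.keys h)"

definition lattice_point :: "real ^ 'v::finite \<Rightarrow> bool" where
  "lattice_point p \<longleftrightarrow> (\<forall>v. p $ v \<in> \<int>)"

definition saturated_newton_polytope :: "('v::finite, 'a::zero) mpoly \<Rightarrow> bool" where
  "saturated_newton_polytope h \<longleftrightarrow>
     (\<forall>p \<in> newton_polytope h. lattice_point p \<longrightarrow>
        (\<exists>\<gamma>. Poly_Mapping.lookup h \<gamma> \<noteq> 0 \<and> p = exponent_point \<gamma>))"

text \<open>
  The resultant of polynomials of degrees \<open>m = CARD('m)\<close> and \<open>n = CARD('n)\<close> with leading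
  coefficients \<open>a\<close> and \<open>b\<close>, written in terms of their roots, which are the indeterminates
  \<open>x\<^sub>i = mp_var (Inl i)\<close> and \<open>y\<^sub>j = mp_var (Inr j)\<close>. As types are nonempty, \<open>m, n \<ge> 1\<close>.
\<close>

definition resultant_in_roots ::
    "complex \<Rightarrow> complex \<Rightarrow> ('m::finite + 'n::finite, complex) mpoly" where
  "resultant_in_roots a b =
     mp_const a ^ CARD('n) * mp_const b ^ CARD('m) *
     (\<Prod>i\<in>(UNIV::'m set). \<Prod>j\<in>(UNIV::'n set). (mp_var (Inl i) - mp_var (Inr j)))"

end

theory Submission
  imports Defs
begin

text \<open>
  Expanding the product amounts to choosing \<open>x\<^sub>i\<close> or \<open>- y\<^sub>j\<close> for every pair \<open>(i, j)\<close>. The sign of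
  a term depends only on its total degree in \<open>y\<close>, so nothing cancels, and the exponent vectors are
  given by the row sums and the complementary column sums of 0-1 matrices. A point of the Newton
  polytope is given in the same way by a matrix with entries in \<open>[0, 1]\<close>. If it is a lattice
  point, every row or column that meets a fractional entry meets two of them, so a dimension count
  yields a nonzero matrix supported on the fractional entries with vanishing row and column sums.
  Moving along it as far as \<open>[0, 1]\<close> permits decreases the number of fractional entries; iterating
  leads to a 0-1 matrix.
\<close>

subsection \<open>Integrality of transportation polytopes\<close>

text \<open>Incidence vectors of the edges of the complete bipartite graph on rows and columns: in a
  combination with weights \<open>D i j\<close>, the \<open>Inl\<close> coordinates are the row sums
  of \<open>D\<close> and the \<open>Inr\<close> coordinates its column sums.\<close>

definition edge_vector :: "'m::finite \<times> 'n::finite \<Rightarrow> real ^ ('m + 'n)" where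
  "edge_vector e = axis (Inl (fst e)) 1 + axis (Inr (snd e)) 1"

lemma edge_vector_nth [simp]:
  "edge_vector e $ Inl i = (if fst e = i then 1 else 0)"
  "edge_vector e $ Inr j = (if snd e = j then 1 else 0)"
  by (auto simp: edge_vector_def axis_def)

lemma inj_edge_vector: "inj edge_vector"
proof (rule injI)
  fix d e :: "'a \<times> 'b"
  assume eq: "edge_vector d = edge_vector e"
  have "edge_vector d $ Inl (fst e) = 1" "edge_vector d $ Inr (snd e) = 1"
    using eq by simp_all
  then show "d = e"
    by (auto simp: prod_eq_iff split: if_splits)
qed

text \<open>Every nonempty fibre of \<open>f\<close> on \<open>F\<close> has at least two elements.
  With \<open>f\<close> a projection, this bounds the number of rows or columns that
  \<open>F\<close> meets by half its size.\<close>

lemma card_ge_twice_image: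
  assumes "finite F" and "\<And>e. e \<in> F \<Longrightarrow> \<exists>e'\<in>F. e' \<noteq> e \<and> f e' = f e"
  shows "2 * card (f ` F) \<le> card F"
proof -
  have "2 \<le> card {e \<in> F. f e = y}" if y: "y \<in> f ` F" for y
  proof -
    obtain e where e: "e \<in> F" "f e = y"
      using y by auto
    obtain e' where e': "e' \<in> F" "e' \<noteq> e" "f e' = f e"
      using assms(2)[OF e(1)] by auto
    have "card {e, e'} \<le> card {e \<in> F. f e = y}"
      by (rule card_mono) (use assms(1) e e' in auto)
    then show ?thesis
      using e' by auto
  qed
  then have "(\<Sum>y\<in>f ` F. 2) \<le> (\<Sum>y\<in>f ` F. card {e \<in> F. f e = y})"
    by (intro sum_mono)
  also have "\<dots> = card F"
    using sum.image_gen[of F "\<lambda>_. 1::nat" f] assms(1) by simp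
  finally show ?thesis
    by simp
qed

text \<open>At most \<open>card F\<close> rows and columns in total are met, so the vectors lie in a
  span of dimension at most \<open>card F\<close>. All of them lie in one proper hyperplane of that
  span, which saves the dimension needed for dependence.\<close>

lemma dependent_edge_vectors:
  fixes F :: "('m::finite \<times> 'n::finite) set"
  assumes "F \<noteq> {}"
    and rows: "\<And>e. e \<in> F \<Longrightarrow> \<exists>e'\<in>F. e' \<noteq> e \<and> fst e' = fst e"
    and cols: "\<And>e. e \<in> F \<Longrightarrow> \<exists>e'\<in>F. e' \<noteq> e \<and> snd e' = snd e"
  shows "dependent (edge_vector ` F)"
proof (rule ccontr)
  assume indep: "independent (edge_vector ` F)"
  \<comment> \<open>A common normal of all edge vectors, expressing that the row sums and the column
    sums of a matrix have the same total.\<close>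
  define w :: "real ^ ('m + 'n)" where "w = (\<chi> k. case k of Inl i \<Rightarrow> 1 | Inr j \<Rightarrow> - 1)"
  define B :: "(real ^ ('m + 'n)) set"
    where "B = (\<lambda>i. axis (Inl i) 1) ` fst ` F \<union> (\<lambda>j. axis (Inr j) 1) ` snd ` F"
  obtain e where e: "e \<in> F"
    using assms(1) by auto
  \<comment> \<open>A unit vector in the span of \<open>B\<close> but off the hyperplane orthogonal
    to \<open>w\<close>. Adjoining it to the supposedly independent family gives
    \<open>card F + 1\<close> independent vectors in that span, which is too many.\<close>
  define b :: "real ^ ('m + 'n)" where "b = axis (Inl (fst e)) 1"
  have orth: "v \<bullet> w = 0" if "v \<in> span (edge_vector ` F)" for v
  proof (rule span_induct[OF that])
    show "subspace {v. v \<bullet> w = 0}"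
      by (auto simp: subspace_def inner_left_distrib)
    show "v \<bullet> w = 0" if "v \<in> edge_vector ` F" for v
      using that by (auto simp: edge_vector_def inner_left_distrib inner_axis' w_def)
  qed
  have "b \<bullet> w = 1"
    by (simp add: b_def w_def inner_axis')
  with orth have b: "b \<notin> span (edge_vector ` F)"
    by fastforce
  then have indep': "independent (insert b (edge_vector ` F))"
    using indep by (simp add: independent_insert)
  have "insert b (edge_vector ` F) \<subseteq> span B"
  proof -
    have "edge_vector d \<in> span B" if "d \<in> F" for d
      unfolding edge_vector_def
      by (rule span_add; rule span_base) (use that in \<open>auto simp: B_def\<close>)
    moreover have "b \<in> span B"
      by (rule span_base) (use e in \<open>auto simp: B_def b_def\<close>)
    ultimately show ?thesis
      by auto
  qed
  then have "card (insert b (edge_vector ` F)) \<le> card B"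
    using independent_span_bound[of B] indep' by (simp add: B_def)
  moreover have "card (insert b (edge_vector ` F)) = Suc (card F)"
  proof -
    have "b \<notin> edge_vector ` F"
      using b by (auto intro: span_base)
    then show ?thesis
      using card_image[OF inj_on_subset[OF inj_edge_vector subset_UNIV], of F] by simp
  qed
  moreover have "card B \<le> card (fst ` F) + card (snd ` F)"
    unfolding B_def by (intro order.trans[OF card_Un_le] add_mono card_image_le) auto
  moreover have "2 * card (fst ` F) \<le> card F" "2 * card (snd ` F) \<le> card F"
    by (rule card_ge_twice_image; use rows cols in simp)+
  ultimately show False
    by linarith
qed

text \<open>The coefficients of a linear relation between the edge vectors of \<open>F\<close>,
  extended by zero, form the matrix; the coordinates of the relation are its row and column
  sums.\<close>

lemma zero_margins_on_support:
  fixes F :: "('m::finite \<times> 'n::finite) set"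
  assumes "F \<noteq> {}"
    and "\<And>e. e \<in> F \<Longrightarrow> \<exists>e'\<in>F. e' \<noteq> e \<and> fst e' = fst e"
    and "\<And>e. e \<in> F \<Longrightarrow> \<exists>e'\<in>F. e' \<noteq> e \<and> snd e' = snd e"
  shows "\<exists>D :: 'm \<Rightarrow> 'n \<Rightarrow> real. (\<forall>i j. D i j \<noteq> 0 \<longrightarrow> (i, j) \<in> F) \<and> (\<exists>i j. D i j \<noteq> 0) \<and>
    (\<forall>i. (\<Sum>j\<in>UNIV. D i j) = 0) \<and> (\<forall>j. (\<Sum>i\<in>UNIV. D i j) = 0)"
proof -
  have "dependent (edge_vector ` F)"
    by (rule dependent_edge_vectors) (use assms in auto)
  then obtain u v where v: "v \<in> edge_vector ` F" "u v \<noteq> 0"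
    and u: "(\<Sum>v\<in>edge_vector ` F. u v *\<^sub>R v) = 0"
    using dependent_finite[of "edge_vector ` F"] by auto
  define D where "D i j = (if (i, j) \<in> F then u (edge_vector (i, j)) else 0)" for i j
  have inj: "inj_on edge_vector F"
    using inj_edge_vector by (rule inj_on_subset) simp
  have "0 = (\<Sum>e\<in>F. u (edge_vector e) *\<^sub>R edge_vector e)"
    using u by (simp add: sum.reindex[OF inj])
  also have "\<dots> = (\<Sum>e\<in>UNIV. D (fst e) (snd e) *\<^sub>R edge_vector e)"
    by (rule sum.mono_neutral_cong_left) (auto simp: D_def)
  also have "\<dots> = (\<Sum>i\<in>UNIV. \<Sum>j\<in>UNIV. D i j *\<^sub>R edge_vector (i, j))"
    by (simp add: UNIV_Times_UNIV[symmetric] sum.cartesian_product case_prod_unfold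
             del: UNIV_Times_UNIV)
  finally have z: "(\<Sum>i\<in>UNIV. \<Sum>j\<in>UNIV. D i j *\<^sub>R edge_vector (i, j)) = 0"
    by simp
  \<comment> \<open>With the row index innermost, the indicator in the \<open>Inl i\<close>
    coordinate collapses the inner sum and leaves a row sum; the order in \<open>z\<close> does the
    same for columns.\<close>
  have swap: "(\<Sum>j\<in>UNIV. \<Sum>i\<in>UNIV. D i j *\<^sub>R edge_vector (i, j)) = 0"
    using z by (subst sum.swap)
  show ?thesis
  proof (intro exI[of _ D] conjI allI impI)
    show "(i, j) \<in> F" if "D i j \<noteq> 0" for i j
      using that by (simp add: D_def split: if_splits)
    show "\<exists>i j. D i j \<noteq> 0"
      using v by (force simp: D_def)
    show "(\<Sum>j\<in>UNIV. D i j) = 0" for i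
      using arg_cong[OF swap, of "\<lambda>v. v $ Inl i"] by (simp add: if_distrib cong: if_cong)
    show "(\<Sum>i\<in>UNIV. D i j) = 0" for j
      using arg_cong[OF z, of "\<lambda>v. v $ Inr j"] by (simp add: if_distrib cong: if_cong)
  qed
qed

lemma sum_Ints_another_non_Int:
  fixes f :: "'a \<Rightarrow> real"
  assumes "finite A" "a \<in> A" "sum f A \<in> \<int>" "f a \<notin> \<int>"
  shows "\<exists>b\<in>A. b \<noteq> a \<and> f b \<notin> \<int>"
proof (rule ccontr)
  assume "\<not> ?thesis"
  then have "sum f (A - {a}) \<in> \<int>"
    by (intro Ints_sum) auto
  then have "sum f A - sum f (A - {a}) \<in> \<int>"
    using assms(3) by (intro Ints_diff)
  then show False
    using assms by (simp add: sum.remove)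
qed

text \<open>A ratio test: start at the point \<open>f\<close> of the unit cube, move in direction
  \<open>d\<close>, and stop when the first moving coordinate reaches a facet.\<close>

lemma unit_interval_exit:
  fixes f d :: "'a \<Rightarrow> real"
  assumes "finite A" and f: "\<And>a. a \<in> A \<Longrightarrow> 0 \<le> f a \<and> f a \<le> 1"
    and "\<exists>a\<in>A. d a \<noteq> 0"
  obtains t a where "a \<in> A" "d a \<noteq> 0" "f a + t * d a \<in> {0, 1}"
    and "\<And>b. b \<in> A \<Longrightarrow> 0 \<le> f b + t * d b \<and> f b + t * d b \<le> 1"
proof -
  define S where "S = {a \<in> A. d a \<noteq> 0}"
  \<comment> \<open>For \<open>d a\<close> nonzero, \<open>s a\<close> is the time at which
    coordinate \<open>a\<close> reaches 1 if it increases, or 0 if it decreases. The minimum is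
    taken over \<open>S\<close> only, so the value at \<open>d a = 0\<close> never enters.\<close>
  define s where "s a = (if d a > 0 then (1 - f a) / d a else f a / - d a)" for a
  have S: "finite S" "S \<noteq> {}"
    using assms by (auto simp: S_def)
  then obtain a where a: "a \<in> S" "s a = Min (s ` S)"
    using Min_in[of "s ` S"] by fastforce
  have min: "s a \<le> s b" if "b \<in> S" for b
    using that S a by simp
  have nonneg: "0 \<le> s b" if "b \<in> S" for b
  proof (cases "d b > 0")
    case True
    then show ?thesis
      using that f[of b] by (auto simp: s_def S_def)
  next
    case False
    then show ?thesis
      using that f[of b] by (auto simp: s_def S_def divide_nonneg_neg)
  qed
  show thesis
  proof
    show "a \<in> A" "d a \<noteq> 0"
      using a(1) by (simp_all add: S_def)
    then show "f a + s a * d a \<in> {0, 1}"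
      by (simp add: s_def)
    show "0 \<le> f b + s a * d b \<and> f b + s a * d b \<le> 1" if b: "b \<in> A" for b
    proof -
      consider "d b = 0" | "d b > 0" | "d b < 0"
        by linarith
      then show ?thesis
      proof cases
        case 1
        then show ?thesis
          using f[OF b] by simp
      next
        case 2
        then have "0 \<le> s a * d b" "s a * d b \<le> s b * d b"
          using min[of b] nonneg[OF a(1)] b by (auto simp: S_def)
        moreover have "s b * d b = 1 - f b"
          using 2 by (simp add: s_def)
        ultimately show ?thesis
          using f[OF b] by auto
      next
        case 3
        then have "s a * d b \<le> 0" "s b * d b \<le> s a * d b"
          using min[of b] nonneg[OF a(1)] b
          by (auto simp: S_def mult_nonneg_nonpos intro: mult_right_mono_neg)
        moreover have "s b * d b = - f b"
          using 3 by (simp add: s_def)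
        ultimately show ?thesis
          using f[OF b] by auto
      qed
    qed
  qed
qed

text \<open>Induction on the number of fractional entries: a perturbation with zero margins
  preserves all row and column sums and can be scaled until a fractional entry becomes 0 or
  1.\<close>

lemma integral_matrix_with_margins:
  fixes M :: "'m::finite \<Rightarrow> 'n::finite \<Rightarrow> real"
  assumes "\<And>i j. 0 \<le> M i j \<and> M i j \<le> 1"
    and "\<And>i. (\<Sum>j\<in>UNIV. M i j) \<in> \<int>" and "\<And>j. (\<Sum>i\<in>UNIV. M i j) \<in> \<int>"
  shows "\<exists>N. (\<forall>i j. N i j \<in> {0, 1}) \<and>
    (\<forall>i. (\<Sum>j\<in>UNIV. N i j) = (\<Sum>j\<in>UNIV. M i j)) \<and>
    (\<forall>j. (\<Sum>i\<in>UNIV. N i j) = (\<Sum>i\<in>UNIV. M i j))"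
  using assms
proof (induction "card {e. M (fst e) (snd e) \<notin> \<int>}" arbitrary: M rule: less_induct)
  case less
  define F where "F = {e. M (fst e) (snd e) \<notin> \<int>}"
  show ?case
  proof (cases "F = {}")
    case True
    have "M i j \<in> {0, 1}" for i j
    proof -
      have "M i j \<in> \<int>"
        using True by (auto simp: F_def)
      then obtain k where k: "M i j = of_int k"
        by (auto elim: Ints_cases)
      then have "0 \<le> k" "k \<le> 1"
        using less.prems(1)[of i j] by auto
      then have "k = 0 \<or> k = 1"
        by auto
      then show ?thesis
        using k by auto
    qed
    then show ?thesis
      by blast
  next
    case False
    \<comment> \<open>A single fractional entry in a row would make the row sum fractional; the same
      holds for columns.\<close>
    have rows: "\<exists>e'\<in>F. e' \<noteq> e \<and> fst e' = fst e" if "e \<in> F" for e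
    proof -
      have "\<exists>j\<in>UNIV. j \<noteq> snd e \<and> M (fst e) j \<notin> \<int>"
        by (rule sum_Ints_another_non_Int) (use that less.prems in \<open>auto simp: F_def\<close>)
      then obtain j where "j \<noteq> snd e" "M (fst e) j \<notin> \<int>"
        by auto
      then show ?thesis
        by (intro bexI[of _ "(fst e, j)"]) (auto simp: F_def prod_eq_iff)
    qed
    have cols: "\<exists>e'\<in>F. e' \<noteq> e \<and> snd e' = snd e" if "e \<in> F" for e
    proof -
      have "\<exists>i\<in>UNIV. i \<noteq> fst e \<and> M i (snd e) \<notin> \<int>"
        by (rule sum_Ints_another_non_Int) (use that less.prems in \<open>auto simp: F_def\<close>)
      then obtain i where "i \<noteq> fst e" "M i (snd e) \<notin> \<int>"
        by auto
      then show ?thesis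
        by (intro bexI[of _ "(i, snd e)"]) (auto simp: F_def prod_eq_iff)
    qed
    have "\<exists>D. (\<forall>i j. D i j \<noteq> 0 \<longrightarrow> (i, j) \<in> F) \<and> (\<exists>i j. D i j \<noteq> 0) \<and>
        (\<forall>i. (\<Sum>j\<in>UNIV. D i j) = (0::real)) \<and> (\<forall>j. (\<Sum>i\<in>UNIV. D i j) = 0)"
      by (rule zero_margins_on_support[OF False]) (fact rows cols)+
    then obtain D :: "'m \<Rightarrow> 'n \<Rightarrow> real"
      where D: "\<And>i j. D i j \<noteq> 0 \<Longrightarrow> (i, j) \<in> F" "\<exists>i j. D i j \<noteq> 0"
        and D0: "\<And>i. (\<Sum>j\<in>UNIV. D i j) = 0" "\<And>j. (\<Sum>i\<in>UNIV. D i j) = 0"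
      by auto
    obtain t e where te: "D (fst e) (snd e) \<noteq> 0"
        "M (fst e) (snd e) + t * D (fst e) (snd e) \<in> {0, 1}"
      and unit: "\<And>e. 0 \<le> M (fst e) (snd e) + t * D (fst e) (snd e) \<and>
        M (fst e) (snd e) + t * D (fst e) (snd e) \<le> 1"
      by (rule unit_interval_exit[of UNIV "\<lambda>e. M (fst e) (snd e)" "\<lambda>e. D (fst e) (snd e)"])
        (use less.prems D(2) in auto)
    define M' where "M' i j = M i j + t * D i j" for i j
    have margins: "(\<Sum>j\<in>UNIV. M' i j) = (\<Sum>j\<in>UNIV. M i j)"
      "(\<Sum>i\<in>UNIV. M' i j) = (\<Sum>i\<in>UNIV. M i j)" for i j
      by (simp_all add: M'_def sum.distrib sum_distrib_left[symmetric] D0)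
    have "{e. M' (fst e) (snd e) \<notin> \<int>} \<subset> F"
    proof
      have "M' i j = M i j" if "(i, j) \<notin> F" for i j
        using D(1) that by (auto simp: M'_def)
      then show "{e. M' (fst e) (snd e) \<notin> \<int>} \<subseteq> F"
        by (auto simp: F_def)
      have "e \<in> F" "M' (fst e) (snd e) \<in> \<int>"
        using D(1)[of "fst e" "snd e"] te by (auto simp: M'_def)
      then show "{e. M' (fst e) (snd e) \<notin> \<int>} \<noteq> F"
        by blast
    qed
    then have "card {e. M' (fst e) (snd e) \<notin> \<int>} < card {e. M (fst e) (snd e) \<notin> \<int>}"
      unfolding F_def by (rule psubset_card_mono[rotated]) simp
    moreover have "0 \<le> M' i j \<and> M' i j \<le> 1" for i j
      using unit[of "(i, j)"] by (simp add: M'_def)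
    ultimately show ?thesis
      using less.hyps[of M'] less.prems by (simp add: margins)
  qed
qed

subsection \<open>Coefficients of the resultant\<close>

text \<open>\<open>S\<close> is the set of factors \<open>x\<^sub>i - y\<^sub>j\<close> from which \<open>x\<^sub>i\<close> is chosen.\<close>

definition choice_exponent :: "('m::finite \<times> 'n::finite) set \<Rightarrow> ('m + 'n) \<Rightarrow>\<^sub>0 nat" where
  "choice_exponent S = (\<Sum>e\<in>S. Poly_Mapping.single (Inl (fst e)) 1)
    + (\<Sum>e\<in>-S. Poly_Mapping.single (Inr (snd e)) 1)"

lemma lookup_choice_exponent:
  "Poly_Mapping.lookup (choice_exponent S) (Inl i) = card {j. (i, j) \<in> S}"
  "Poly_Mapping.lookup (choice_exponent S) (Inr j) = card {i. (i, j) \<notin> S}"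
proof -
  have "Poly_Mapping.lookup (choice_exponent S) (Inl i) = (\<Sum>e\<in>S. if fst e = i then 1 else 0)"
    by (simp add: choice_exponent_def lookup_add lookup_sum lookup_single when_def cong: if_cong)
  also have "\<dots> = card {e \<in> S. fst e = i}"
    by (simp add: sum.If_cases Int_def)
  also have "{e \<in> S. fst e = i} = Pair i ` {j. (i, j) \<in> S}"
    by auto
  finally show "Poly_Mapping.lookup (choice_exponent S) (Inl i) = card {j. (i, j) \<in> S}"
    by (simp add: card_image inj_on_def)
  have "Poly_Mapping.lookup (choice_exponent S) (Inr j) = (\<Sum>e\<in>-S. if snd e = j then 1 else 0)"
    by (simp add: choice_exponent_def lookup_add lookup_sum lookup_single when_def cong: if_cong)
  also have "\<dots> = card {e \<in> -S. snd e = j}"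
    by (simp add: sum.If_cases Int_def)
  also have "{e \<in> -S. snd e = j} = (\<lambda>i. (i, j)) ` {i. (i, j) \<notin> S}"
    by auto
  finally show "Poly_Mapping.lookup (choice_exponent S) (Inr j) = card {i. (i, j) \<notin> S}"
    by (simp add: card_image inj_on_def)
qed

lemma exponent_point_choice_exponent:
  "exponent_point (choice_exponent S) $ Inl i = (\<Sum>j\<in>UNIV. of_bool ((i, j) \<in> S))"
  "exponent_point (choice_exponent S) $ Inr j = (\<Sum>i\<in>UNIV. 1 - of_bool ((i, j) \<in> S))"
proof -
  show "exponent_point (choice_exponent S) $ Inl i = (\<Sum>j\<in>UNIV. of_bool ((i, j) \<in> S))"
    by (simp add: exponent_point_def lookup_choice_exponent)
  have "(\<Sum>i\<in>UNIV. 1 - of_bool ((i, j) \<in> S)) = (\<Sum>i\<in>UNIV. of_bool ((i, j) \<notin> S) :: real)"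
    by (intro sum.cong) auto
  then show "exponent_point (choice_exponent S) $ Inr j = (\<Sum>i\<in>UNIV. 1 - of_bool ((i, j) \<in> S))"
    by (simp add: exponent_point_def lookup_choice_exponent)
qed

text \<open>Each pair outside \<open>S\<close> contributes one factor \<open>y\<close>, so the sign
  of a term is determined by its exponent vector. This is what excludes cancellation.\<close>

lemma card_Compl_eq_degree:
  "card (- S) = (\<Sum>j\<in>UNIV. Poly_Mapping.lookup (choice_exponent S) (Inr j))"
proof -
  have "- S = (\<lambda>(j, i). (i, j)) ` (SIGMA j:UNIV. {i. (i, j) \<notin> S})"
    by auto
  also have "card \<dots> = card (SIGMA j:UNIV. {i. (i, j) \<notin> S})"
    by (rule card_image) (auto simp: inj_on_def)
  finally show ?thesis
    by (simp add: lookup_choice_exponent)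
qed

lemma prod_single:
  "(\<Prod>e\<in>S. Poly_Mapping.single (g e) (c e :: 'a::comm_semiring_1)) =
    Poly_Mapping.single (\<Sum>e\<in>S. g e :: 'b::comm_monoid_add) (\<Prod>e\<in>S. c e)"
  by (induction S rule: infinite_finite_induct) (auto simp: mult_single)

lemma mp_const_power: "mp_const (c :: 'a::comm_semiring_1) ^ k = mp_const (c ^ k)"
  by (induction k) (auto simp: mp_const_def mult_single)

lemma resultant_in_roots_eq_sum:
  "(resultant_in_roots a b :: ('m::finite + 'n::finite, complex) mpoly) =
    (\<Sum>S\<in>UNIV. Poly_Mapping.single (choice_exponent S)
      (a ^ CARD('n) * b ^ CARD('m) * (- 1) ^ card (- S)))"
proof -
  let ?x = "\<lambda>e :: 'm \<times> 'n. Poly_Mapping.single (Poly_Mapping.single (Inl (fst e) :: 'm + 'n) 1) 1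
    :: ('m + 'n, complex) mpoly"
  let ?y = "\<lambda>e :: 'm \<times> 'n. Poly_Mapping.single (Poly_Mapping.single (Inr (snd e) :: 'm + 'n) 1) (- 1)
    :: ('m + 'n, complex) mpoly"
  have "(\<Prod>i\<in>(UNIV::'m set). \<Prod>j\<in>(UNIV::'n set).
      (mp_var (Inl i) - mp_var (Inr j) :: ('m + 'n, complex) mpoly)) = (\<Prod>e\<in>UNIV. ?x e + ?y e)"
    by (simp add: UNIV_Times_UNIV[symmetric] prod.cartesian_product case_prod_unfold mp_var_def
          single_uminus del: UNIV_Times_UNIV)
  also have "\<dots> = (\<Sum>S\<in>UNIV. prod ?x S * prod ?y (- S))"
    by (simp add: prod_add Compl_eq_Diff_UNIV)
  also have "\<dots> = (\<Sum>S\<in>UNIV. Poly_Mapping.single (choice_exponent S) ((- 1) ^ card (- S)))"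
    by (simp add: prod_single mult_single choice_exponent_def)
  finally show ?thesis
    by (simp add: resultant_in_roots_def mp_const_power)
      (simp add: mp_const_def mult_single sum_distrib_left)
qed

text \<open>All choices \<open>S\<close> with the same exponent vector contribute the same
  coefficient, so the sum is that coefficient times their number. In characteristic zero it vanishes
  only if there is no such \<open>S\<close>, provided \<open>a\<close> and \<open>b\<close> are
  nonzero.\<close>

lemma lookup_resultant_in_roots:
  "Poly_Mapping.lookup (resultant_in_roots a b :: ('m::finite + 'n::finite, complex) mpoly) \<gamma> =
    a ^ CARD('n) * b ^ CARD('m) * (- 1) ^ (\<Sum>j\<in>UNIV. Poly_Mapping.lookup \<gamma> (Inr j)) *
    of_nat (card {S. choice_exponent S = \<gamma>})"
proof -
  let ?c = "a ^ CARD('n) * b ^ CARD('m) * (- 1) ^ (\<Sum>j\<in>UNIV. Poly_Mapping.lookup \<gamma> (Inr j))"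
  have "Poly_Mapping.lookup (resultant_in_roots a b :: ('m + 'n, complex) mpoly) \<gamma> =
      (\<Sum>S\<in>UNIV. if choice_exponent S = \<gamma> then ?c else 0)"
    unfolding resultant_in_roots_eq_sum lookup_sum
    by (intro sum.cong) (auto simp: lookup_single when_def card_Compl_eq_degree)
  then show ?thesis
    by (simp add: sum.If_cases)
qed

lemma keys_resultant_in_roots:
  assumes "a \<noteq> 0" and "b \<noteq> 0"
  shows "Poly_Mapping.keys (resultant_in_roots a b) = range choice_exponent"
proof -
  have "{S. choice_exponent S = \<gamma>} = {} \<longleftrightarrow> \<gamma> \<notin> range choice_exponent" for \<gamma> :: "'a + 'b \<Rightarrow>\<^sub>0 nat"
    by auto
  then show ?thesis
    using assms by (auto simp: in_keys_iff lookup_resultant_in_roots)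
qed

subsection \<open>Saturation\<close>

text \<open>Extends the exponent formula from indicator matrices to real ones. The map is affine in
  \<open>M\<close>; the complement \<open>1 - M i j\<close> reflects that \<open>y\<close> is chosen
  wherever \<open>x\<close> is not.\<close>

definition matrix_point :: "('m::finite \<Rightarrow> 'n::finite \<Rightarrow> real) \<Rightarrow> real ^ ('m + 'n)" where
  "matrix_point M =
    (\<chi> k. case k of Inl i \<Rightarrow> \<Sum>j\<in>UNIV. M i j | Inr j \<Rightarrow> \<Sum>i\<in>UNIV. 1 - M i j)"

lemma exponent_point_eq_matrix_point:
  "exponent_point (choice_exponent S) = matrix_point (\<lambda>i j. of_bool ((i, j) \<in> S))"
  by (auto simp: vec_eq_iff matrix_point_def exponent_point_choice_exponent split: sum.split)

lemma convex_matrix_points: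
  "convex (matrix_point ` {M :: 'm::finite \<Rightarrow> 'n::finite \<Rightarrow> real. \<forall>i j. 0 \<le> M i j \<and> M i j \<le> 1})"
proof (rule convexI, clarify)
  fix M N :: "'m \<Rightarrow> 'n \<Rightarrow> real" and s t :: real
  assume MN: "\<forall>i j. 0 \<le> M i j \<and> M i j \<le> 1" "\<forall>i j. 0 \<le> N i j \<and> N i j \<le> 1"
    and st: "0 \<le> s" "0 \<le> t" "s + t = 1"
  let ?L = "\<lambda>i j. s * M i j + t * N i j"
  have "s *\<^sub>R matrix_point M + t *\<^sub>R matrix_point N = matrix_point ?L"
  proof -
    \<comment> \<open>Because \<open>s + t = 1\<close>, the constant 1 of the column block survives
      convex combination.\<close>
    have "s * (1 - x) + t * (1 - y) = 1 - (s * x + t * y)" for x y :: real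
      using st by (simp add: algebra_simps)
    then show ?thesis
      by (auto simp: vec_eq_iff matrix_point_def sum_distrib_left sum.distrib[symmetric]
            simp del: sum_subtractf split: sum.split)
  qed
  moreover have "0 \<le> ?L i j \<and> ?L i j \<le> 1" for i j
    using MN st by (auto intro: convex_bound_le)
  ultimately show "s *\<^sub>R matrix_point M + t *\<^sub>R matrix_point N \<in>
      matrix_point ` {M. \<forall>i j. 0 \<le> M i j \<and> M i j \<le> 1}"
    by blast
qed

text \<open>A lattice point forces integral margins of \<open>M\<close>, the column sums being
  \<open>CARD('m)\<close> minus a coordinate. Since the point depends on the margins only,
  \<open>M\<close> may be replaced by a 0-1 matrix, which is the indicator of some
  \<open>S\<close>.\<close>

lemma lattice_matrix_point_is_exponent:
  fixes M :: "'m::finite \<Rightarrow> 'n::finite \<Rightarrow> real"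
  assumes "lattice_point (matrix_point M)" and "\<And>i j. 0 \<le> M i j \<and> M i j \<le> 1"
  shows "\<exists>S. matrix_point M = exponent_point (choice_exponent S)"
proof -
  have row: "(\<Sum>j\<in>UNIV. M i j) \<in> \<int>" for i
    using assms(1)[unfolded lattice_point_def, rule_format, of "Inl i"]
    by (simp add: matrix_point_def)
  have col: "(\<Sum>i\<in>UNIV. M i j) \<in> \<int>" for j
  proof -
    have "real CARD('m) - (\<Sum>i\<in>UNIV. M i j) \<in> \<int>"
      using assms(1)[unfolded lattice_point_def, rule_format, of "Inr j"]
      by (simp add: matrix_point_def sum_subtractf)
    then have "real CARD('m) - (real CARD('m) - (\<Sum>i\<in>UNIV. M i j)) \<in> \<int>"
      by (rule Ints_diff[OF Ints_of_nat])
    then show ?thesis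
      by (simp only: diff_diff_eq2 add_diff_cancel_left')
  qed
  obtain N where N: "\<And>i j. N i j \<in> {0, 1}"
    and margins: "\<And>i. (\<Sum>j\<in>UNIV. N i j) = (\<Sum>j\<in>UNIV. M i j)"
      "\<And>j. (\<Sum>i\<in>UNIV. N i j) = (\<Sum>i\<in>UNIV. M i j)"
    using integral_matrix_with_margins[of M] assms(2) row col by auto
  have "matrix_point M = matrix_point N"
    by (auto simp: matrix_point_def vec_eq_iff margins sum_subtractf split: sum.split)
  also have "N = (\<lambda>i j. of_bool ((i, j) \<in> {e. N (fst e) (snd e) = 1}))"
    using N by (fastforce simp: fun_eq_iff)
  finally show ?thesis
    unfolding exponent_point_eq_matrix_point[symmetric] by blast
qed

theorem theorem2p20:
  fixes a b :: complex
  assumes "a \<noteq> 0" and "b \<noteq> 0"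
  shows "saturated_newton_polytope
    (resultant_in_roots a b :: ('m::finite + 'n::finite, complex) mpoly)"
  unfolding saturated_newton_polytope_def
proof (intro ballI impI)
  let ?R = "resultant_in_roots a b :: ('m + 'n, complex) mpoly"
  fix p
  assume p: "p \<in> newton_polytope ?R" "lattice_point p"
  \<comment> \<open>The points of matrices over [0, 1] form a convex set containing every exponent
    vector, hence also the convex hull.\<close>
  have "newton_polytope ?R \<subseteq> matrix_point ` {M. \<forall>i j. 0 \<le> M i j \<and> M i j \<le> 1}"
    unfolding newton_polytope_def keys_resultant_in_roots[OF assms]
    by (rule hull_minimal) (auto simp: exponent_point_eq_matrix_point convex_matrix_points)
  then obtain M where "p = matrix_point M" "\<And>i j. 0 \<le> M i j \<and> M i j \<le> 1"
    using p(1) by auto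
  then obtain S where "p = exponent_point (choice_exponent S)"
    using lattice_matrix_point_is_exponent p(2) by metis
  moreover have "choice_exponent S \<in> Poly_Mapping.keys ?R"
    by (simp add: keys_resultant_in_roots[OF assms])
  ultimately show "\<exists>\<gamma>. Poly_Mapping.lookup ?R \<gamma> \<noteq> 0 \<and> p = exponent_point \<gamma>"
    by (auto simp: in_keys_iff)
qed

end
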